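(* Let $S^k$ be a $k$-uniform sunflower hypergraph. If $k\ge2$ is an integer, then the characteristic polynomial of $S^k$ is $$P_A(\lambda)=(1+\lambda)^{(k-1)(k-2)}\left((2-3k+k^2)+(6-6k+k^2)\lambda+(4-2k)\lambda^2+\lambda^3\right)\left((-3+2k)+(k-3)\lambda-\lambda^2\right)^{k-2}.$$
   Context: A hypergraph $G^*=(V,E)$ has a finite vertex set $V=\{v_1,\dots,v_N\}$ and a finite set $E$ of hyperedges, each a subset of $V$. Its adjacency matrix $A=(a_{ij})$ has $a_{ij}=|\{e\in E:\{v_i,v_j\}\subset e\}|$ for $i\ne j$ and $a_{ii}=0$. The sunflower hypergraph $S^k$ is the $k$-uniform hypergraph of order $k(k-1)+1$ with vertices $v_{0,0}$ and $v_{i,j}$ ($1\le i\le k-1$, $1\le j\le k$) and hyperedges $\{v_{i,1},v_{i,2},\dots,v_{i,k}\}$ for $1\le i\le k-1$ together with $\{v_{0,0},v_{1,1},v_{2,1},\dots,v_{k-1,1}\}$. The characteristic polynomial of $S^k$ is the characteristic polynomial of its adjacency matrix $A$, written as $\det(A-\lambda I)$.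
   Formalization: The right-hand side is multiplied by (-1)^(k-1): the printed formula has the wrong sign for even k (for k=2, det(A-λI) = -λ^3+2λ, but the formula gives λ^3-2λ); for odd k it is unchanged. *)

theory Defs
  imports "Jordan_Normal_Form.Char_Poly"
begin

locale hypergraph =
  fixes V :: "'a set" and E :: "'a set set"
  assumes finite_V: "finite V" and E_subset: "E \<subseteq> Pow V"

definition uniform :: "nat \<Rightarrow> 'a set set \<Rightarrow> bool" where
  "uniform k E \<longleftrightarrow> (\<forall>e\<in>E. card e = k)"

(* The list vs is the enumeration v_1, ..., v_N of the vertex set that indexes rows and columns. *)
definition adjacency_matrix :: "'a set set \<Rightarrow> 'a list \<Rightarrow> real mat" where
  "adjacency_matrix E vs = mat (length vs) (length vs)
     (\<lambda>(i, j). if i = j then 0 else real (card {e \<in> E. {vs ! i, vs ! j} \<subseteq> e}))"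

(* det (A - lambda I), as a polynomial in lambda.  The constant char_poly of the library is
   det (lambda I - A), which differs by the sign (-1)^n for an n by n matrix. *)
definition char_polynomial :: "'a::comm_ring_1 mat \<Rightarrow> 'a poly" where
  "char_polynomial A = det (map_mat (\<lambda>a. [:a:]) A - [:0, 1:] \<cdot>\<^sub>m 1\<^sub>m (dim_row A))"

(* The pair (i, j) stands for the vertex v_{i,j}. *)
definition sunflower_verts :: "nat \<Rightarrow> (nat \<times> nat) set" where
  "sunflower_verts k = insert (0, 0) ({1..k - 1} \<times> {1..k})"

definition sunflower_edges :: "nat \<Rightarrow> (nat \<times> nat) set set" where
  "sunflower_edges k =
     insert (insert (0, 0) {(i, 1) | i. i \<in> {1..k - 1}})
       {{(i, j) | j. j \<in> {1..k}} | i. i \<in> {1..k - 1}}"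

lemma hypergraph_sunflower:
  assumes "k \<ge> 1"
  shows "hypergraph (sunflower_verts k) (sunflower_edges k)"
  using assms by unfold_locales (auto simp: sunflower_verts_def sunflower_edges_def)

lemma card_sunflower_verts: "card (sunflower_verts k) = k * (k - 1) + 1"
  by (simp add: sunflower_verts_def card_cartesian_product mult.commute)

lemma uniform_sunflower:
  assumes "k \<ge> 1"
  shows "uniform k (sunflower_edges k)"
proof -
  have "{(i, 1::nat) | i. i \<in> {1..k - 1}} = (\<lambda>i. (i, 1)) ` {1..k - 1}"
    by auto
  then have "card (insert (0, 0) {(i, 1::nat) | i. i \<in> {1..k - 1}}) = k"
    using assms by (subst card_insert_disjoint) (auto simp: card_image inj_on_def)
  moreover have "card {(i, j) | j. j \<in> {1..k}} = k" for i :: nat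
  proof -
    have "{(i, j) | j. j \<in> {1..k}} = Pair i ` {1..k}"
      by auto
    then show ?thesis
      by (simp add: card_image inj_on_def)
  qed
  ultimately show ?thesis
    unfolding uniform_def sunflower_edges_def by auto
qed

end

theory Submission
  imports Defs
begin

text \<open>
  The adjacency matrix is \<open>B B\<^sup>T - \<Delta>\<close>, where \<open>B\<close> is the vertex-edge incidence matrix and \<open>\<Delta>\<close>
  the diagonal matrix of degrees. Hence, for all but finitely many \<open>x\<close>, Sylvester's determinant
  identity turns \<open>det (A - x I)\<close> into \<open>det (- (\<Delta> + x I)) det (I - B\<^sup>T (\<Delta> + x I)\<^sup>-\<^sup>1 B)\<close>, whose second
  factor has one row per edge. As the petals of a sunflower are pairwise disjoint and meet the
  central edge in one vertex each, that factor is the determinant of a \<open>k \<times> k\<close> arrow matrix.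
\<close>

section \<open>Schur complements and determinants of arrow matrices\<close>

text \<open>Multiplying on the right by a block unitriangular matrix, of determinant 1, clears the
  lower left block. The inverse \<open>D'\<close> is passed explicitly, so no field is
  required.\<close>

lemma det_four_block_mat_schur:
  fixes A :: "'a :: idom mat"
  assumes A: "A \<in> carrier_mat n n" and B: "B \<in> carrier_mat n m"
    and C: "C \<in> carrier_mat m n" and D: "D \<in> carrier_mat m m"
    and D': "D' \<in> carrier_mat m m" and inv: "D * D' = 1\<^sub>m m"
  shows "det (four_block_mat A B C D) = det D * det (A - B * (D' * C))"
proof -
  let ?M = "four_block_mat A B C D"
  let ?N = "four_block_mat (1\<^sub>m n) (0\<^sub>m n m) (- (D' * C)) (1\<^sub>m m)"
  have cancel: "D * (D' * C) = C"
    using assoc_mult_mat[OF D D' C] inv C by simp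
  have "?M * ?N = four_block_mat (A - B * (D' * C)) B (0\<^sub>m m n) D"
    by (subst mult_four_block_mat[OF A B C D]; insert A B C D D' cancel)
      (auto simp: add_uminus_minus_mat[of _ n n] add_uminus_minus_mat[of _ m n]
         mult_carrier_mat[OF D' C])
  then have "det (?M * ?N) = det (A - B * (D' * C)) * det D"
    using A B C D D' by (simp only:) (intro det_four_block_mat_lower_left_zero[of _ n _ m], auto)
  moreover have "det ?N = 1"
    using D' C by (simp add: det_four_block_mat_upper_right_zero[of _ n _ m])
  moreover have "det (?M * ?N) = det ?M * det ?N"
    using A B C D D' by (intro det_mult[of _ "n + m"]) auto
  ultimately show ?thesis
    by (simp add: mult.commute)
qed

text \<open>Both sides are the determinant of the block matrix with rows \<open>1, B\<close> and \<open>C, D\<close>.\<close>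

lemma det_minus_mult_mat:
  fixes B :: "'a :: idom mat"
  assumes B: "B \<in> carrier_mat n m" and C: "C \<in> carrier_mat m n"
    and D: "D \<in> carrier_mat m m" and D': "D' \<in> carrier_mat m m" and inv: "D * D' = 1\<^sub>m m"
  shows "det (D - C * B) = det D * det (1\<^sub>m n - B * (D' * C))"
proof -
  let ?M = "four_block_mat (1\<^sub>m n) B C D"
  let ?N = "four_block_mat (1\<^sub>m n) (- B) (0\<^sub>m m n) (1\<^sub>m m)"
  have "?M * ?N = four_block_mat (1\<^sub>m n) (0\<^sub>m n m) C (D - C * B)"
    using B C D by (subst mult_four_block_mat[of _ n n _ m _ m])
      (auto simp: uminus_l_inv_mat[of _ n m] add_uminus_minus_mat[of _ m m]
        comm_add_mat[of "- (C * B)" m m])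
  then have "det (?M * ?N) = det (D - C * B)"
    using B C D by (simp add: det_four_block_mat_upper_right_zero[OF one_carrier_mat refl C, of "D - C * B"]
      minus_carrier_mat mult_carrier_mat[OF C B])
  moreover have "det ?N = 1"
    using B by (simp add: det_four_block_mat_lower_left_zero[of _ n _ m])
  moreover have "det (?M * ?N) = det ?M * det ?N"
    using B C D by (intro det_mult[of _ "n + m"]) auto
  ultimately show ?thesis
    using det_four_block_mat_schur[OF _ B C D D' inv, of "1\<^sub>m n"] by simp
qed

lemma det_diagonal_mat:
  "det (mat n n (\<lambda>(i, j). if i = j then d i else 0)) = (\<Prod>i<n. d i)"
  by (subst det_upper_triangular[of _ n])
    (auto simp: prod_list_diag_prod atLeast0LessThan intro!: prod.cong)

lemma diagonal_mat_mult:
  assumes "C \<in> carrier_mat n m"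
  shows "mat n n (\<lambda>(i, j). if i = j then d i else 0) * C = mat n m (\<lambda>(i, j). d i * C $$ (i, j))"
proof (rule eq_matI; simp only: dim_row_mat dim_col_mat index_mult_mat)
  fix i j assume ij: "i < n" "j < m"
  have "(\<Sum>l = 0..<n. (if i = l then d i else 0) * C $$ (l, j)) =
      (\<Sum>l = 0..<n. if i = l then d i * C $$ (l, j) else 0)"
    by (intro sum.cong) auto
  then show "(mat n n (\<lambda>(i, j). if i = j then d i else 0) * C) $$ (i, j) =
      mat n m (\<lambda>(i, j). d i * C $$ (i, j)) $$ (i, j)"
    using ij assms by (simp add: scalar_prod_def)
qed (use assms in auto)

lemma diagonal_mat_inverse:
  fixes d :: "nat \<Rightarrow> 'a :: field"
  assumes "\<And>i. i < n \<Longrightarrow> d i \<noteq> 0"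
  shows "mat n n (\<lambda>(i, j). if i = j then d i else 0) *
    mat n n (\<lambda>(i, j). if i = j then 1 / d i else 0) = 1\<^sub>m n"
  by (subst diagonal_mat_mult[of _ n n]; (rule eq_matI)?) (use assms in auto)

text \<open>For an incidence matrix \<open>b\<close> this trades one row per vertex for one row per
  edge: it is \<open>det_minus_mult_mat\<close> applied to \<open>b\<close> and its
  transpose.\<close>

lemma det_diagonal_minus_gram:
  fixes d :: "nat \<Rightarrow> 'a :: field" and b :: "nat \<Rightarrow> nat \<Rightarrow> 'a"
  assumes "\<And>i. i < n \<Longrightarrow> d i \<noteq> 0"
  shows "det (mat n n (\<lambda>(i, j). (if i = j then d i else 0) - (\<Sum>e<m. b i e * b j e))) =
    (\<Prod>i<n. d i) * det (mat m m (\<lambda>(e, f). of_bool (e = f) - (\<Sum>i<n. b i e * b i f / d i)))"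
proof -
  let ?B = "mat n m (\<lambda>(i, e). b i e)"
  let ?T = "mat m n (\<lambda>(e, i). b i e)"
  let ?D = "mat n n (\<lambda>(i, j). if i = j then d i else 0)"
  let ?D' = "mat n n (\<lambda>(i, j). if i = j then 1 / d i else 0)"
  have "?D' * ?B = mat n m (\<lambda>(i, e). b i e / d i)"
    by (subst diagonal_mat_mult[of _ n m]) auto
  then have "1\<^sub>m m - ?T * (?D' * ?B) =
      mat m m (\<lambda>(e, f). of_bool (e = f) - (\<Sum>i<n. b i e * b i f / d i))"
    by (intro eq_matI) (auto simp: scalar_prod_def atLeast0LessThan)
  moreover have "?D - ?B * ?T =
      mat n n (\<lambda>(i, j). (if i = j then d i else 0) - (\<Sum>e<m. b i e * b j e))"
    by (intro eq_matI) (auto simp: scalar_prod_def atLeast0LessThan)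
  moreover have "det (?D - ?B * ?T) = det ?D * det (1\<^sub>m m - ?T * (?D' * ?B))"
    by (rule det_minus_mult_mat) (use assms in \<open>auto simp: diagonal_mat_inverse\<close>)
  ultimately show ?thesis
    by (simp add: det_diagonal_mat)
qed

text \<open>Eliminating the diagonal block leaves a 1 by 1 Schur complement at the corner.\<close>

lemma det_arrow_mat:
  fixes a b c :: "'a :: field"
  assumes "a \<noteq> 0"
  shows "det (mat (Suc n) (Suc n) (\<lambda>(i, j).
      if i = j then (if i = 0 then b else a) else if i = 0 \<or> j = 0 then c else 0)) =
    a ^ n * (b - of_nat n * c\<^sup>2 / a)" (is "det ?M = _")
proof -
  let ?A = "mat 1 1 (\<lambda>_. b)" and ?B = "mat 1 n (\<lambda>_. c)" and ?C = "mat n 1 (\<lambda>_. c)"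
  let ?D = "mat n n (\<lambda>(i, j). if i = j then a else 0)"
  let ?D' = "mat n n (\<lambda>(i, j). if i = j then 1 / a else 0)"
  have "?M = four_block_mat ?A ?B ?C ?D"
    by (intro eq_matI) auto
  then have "det ?M = det ?D * det (?A - ?B * (?D' * ?C))"
    using det_four_block_mat_schur[of ?A 1 ?B n ?C ?D ?D'] assms diagonal_mat_inverse[of n "\<lambda>_. a"]
    by simp
  also have "?D' * ?C = mat n 1 (\<lambda>_. c / a)"
    by (subst diagonal_mat_mult[of _ n 1]) auto
  also have "det (?A - ?B * mat n 1 (\<lambda>_. c / a)) = b - of_nat n * c\<^sup>2 / a"
    by (subst det_single) (auto simp: scalar_prod_def power2_eq_square)
  finally show ?thesis
    by (simp add: det_diagonal_mat)
qed

section \<open>Values of the characteristic polynomial through the edges\<close>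

text \<open>Evaluation is a ring homomorphism, hence commutes with \<open>det\<close>. Passing to
  values makes division by \<open>deg E v + x\<close> possible.\<close>

lemma poly_char_polynomial:
  assumes "A \<in> carrier_mat n n"
  shows "poly (char_polynomial A) x = det (A - x \<cdot>\<^sub>m 1\<^sub>m n)"
proof -
  have "poly (char_polynomial A) x =
      det (map_mat (\<lambda>p. poly p x) (map_mat (\<lambda>a. [:a:]) A - [:0, 1:] \<cdot>\<^sub>m 1\<^sub>m n))"
    unfolding char_polynomial_def using assms by (simp add: comm_ring_hom.hom_det[OF poly_hom.comm_ring_hom_axioms])
  also have "map_mat (\<lambda>p. poly p x) (map_mat (\<lambda>a. [:a:]) A - [:0, 1:] \<cdot>\<^sub>m 1\<^sub>m n) =
      A - x \<cdot>\<^sub>m 1\<^sub>m n"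
    using assms by (intro eq_matI) auto
  finally show ?thesis .
qed

lemma poly_char_polynomial_adjacency:
  fixes x :: real
  defines "deg \<equiv> \<lambda>E v. real (card {e \<in> E. v \<in> e})"
  assumes vs: "distinct vs" and inj: "inj_on edge {..<m}" and E: "E = edge ` {..<m}"
    and nz: "\<And>v. v \<in> set vs \<Longrightarrow> deg E v + x \<noteq> 0"
  shows "poly (char_polynomial (adjacency_matrix E vs)) x =
    (- 1) ^ length vs * (\<Prod>v\<in>set vs. deg E v + x) *
    det (mat m m (\<lambda>(e, f). of_bool (e = f) -
      (\<Sum>v \<in> set vs \<inter> (edge e \<inter> edge f). 1 / (deg E v + x))))"
proof -
  let ?n = "length vs" and ?d = "\<lambda>i. deg E (vs ! i) + x"
  let ?b = "\<lambda>i e. of_bool (vs ! i \<in> edge e) :: real"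
  let ?G = "mat ?n ?n (\<lambda>(i, j). (if i = j then ?d i else 0) - (\<Sum>e<m. ?b i e * ?b j e))"
  have common: "(\<Sum>e<m. of_bool (u \<in> edge e) * of_bool (v \<in> edge e)) =
      real (card {e \<in> E. {u, v} \<subseteq> e})" for u v
  proof -
    have "(\<Sum>e<m. of_bool (u \<in> edge e) * of_bool (v \<in> edge e) :: real) =
        (\<Sum>e\<in>E. of_bool ({u, v} \<subseteq> e))"
      unfolding E sum.reindex[OF inj] by (intro sum.cong) auto
    also have "\<dots> = real (card {e \<in> E. {u, v} \<subseteq> e})"
      using E by (subst sum_of_bool_eq) (auto simp: Int_def)
    finally show ?thesis .
  qed
  have reindex: "(\<Sum>i<?n. f (vs ! i)) = (\<Sum>v\<in>set vs. f v)"
    "(\<Prod>i<?n. f (vs ! i)) = (\<Prod>v\<in>set vs. f v)" for f :: "'a \<Rightarrow> real"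
    using bij_betw_nth[OF vs, of "{..<?n}" "set vs"]
    by (simp_all add: sum.reindex_bij_betw prod.reindex_bij_betw)
  have gram: "(\<Sum>i<?n. ?b i e * ?b i f / ?d i) =
      (\<Sum>v \<in> set vs \<inter> (edge e \<inter> edge f). 1 / (deg E v + x))" for e f
    unfolding reindex[of "\<lambda>v. of_bool (v \<in> edge e) * of_bool (v \<in> edge f) / (deg E v + x)"]
    by (rule sum.mono_neutral_cong_right) auto
  \<comment> \<open>On the diagonal the number of common edges is the degree, which cancels in
    \<open>?d i\<close> and leaves \<open>x\<close>.\<close>
  have "adjacency_matrix E vs - x \<cdot>\<^sub>m 1\<^sub>m ?n = (- 1) \<cdot>\<^sub>m ?G"
    unfolding common adjacency_matrix_def deg_def by (intro eq_matI) auto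
  then have "poly (char_polynomial (adjacency_matrix E vs)) x = (- 1) ^ ?n * det ?G"
    by (subst poly_char_polynomial[of _ ?n]) (auto simp: adjacency_matrix_def)
  also have "det ?G = (\<Prod>i<?n. ?d i) *
      det (mat m m (\<lambda>(e, f). of_bool (e = f) - (\<Sum>i<?n. ?b i e * ?b i f / ?d i)))"
    by (rule det_diagonal_minus_gram) (use nz in auto)
  finally show ?thesis
    unfolding gram reindex(2)[of "\<lambda>v. deg E v + x"] by simp
qed

text \<open>\<open>(p - q) * r\<close> vanishes everywhere, so it is zero. This allows the points
  where denominators vanish to be skipped.\<close>

lemma poly_eqI_nonroot:
  fixes p q r :: "'a :: {idom, ring_char_0} poly"
  assumes "r \<noteq> 0" and "\<And>x. poly r x \<noteq> 0 \<Longrightarrow> poly p x = poly q x"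
  shows "p = q"
proof -
  have "poly ((p - q) * r) x = 0" for x
    using assms(2)[of x] by auto
  then have "(p - q) * r = 0"
    using poly_all_0_iff_0 by blast
  with assms(1) show ?thesis by simp
qed

section \<open>Edges, degrees and weighted intersections of the sunflower\<close>

text \<open>The central edge has number 0, so that it becomes the corner of the arrow
  matrix.\<close>

definition sunflower_edge :: "nat \<Rightarrow> nat \<Rightarrow> (nat \<times> nat) set" where
  "sunflower_edge k e =
    (if e = 0 then insert (0, 0) ({1..k - 1} \<times> {1}) else {e} \<times> {1..k})"

lemma sunflower_edges_eq:
  assumes "k \<ge> 1"
  shows "sunflower_edges k = sunflower_edge k ` {..<k}"
proof -
  have "{..<k} = insert 0 {1..k - 1}"
    using assms by auto
  moreover have "sunflower_edge k ` {1..k - 1} = (\<lambda>i. {i} \<times> {1..k}) ` {1..k - 1}"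
    by (intro image_cong) (auto simp: sunflower_edge_def)
  moreover have "{{(i, j) | j. j \<in> {1..k}} | i. i \<in> {1..k - 1}} =
      (\<lambda>i. {i} \<times> {1..k}) ` {1..k - 1}"
    unfolding Setcompr_eq_image by (intro image_cong) auto
  moreover have "{(i, 1) | i. i \<in> {1..k - 1}} = {1..k - 1} \<times> {1::nat}"
    by auto
  ultimately show ?thesis
    unfolding sunflower_edges_def by (metis image_insert sunflower_edge_def)
qed

lemma inj_on_sunflower_edge:
  assumes "k \<ge> 1"
  shows "inj_on (sunflower_edge k) {..<k}"
proof (rule inj_onI)
  fix e f assume "sunflower_edge k e = sunflower_edge k f"
  moreover have "(0, 0) \<in> sunflower_edge k g \<longleftrightarrow> g = 0" for g
    by (auto simp: sunflower_edge_def)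
  moreover have "(h, 1) \<in> sunflower_edge k g \<longleftrightarrow> h = g" if "g \<noteq> 0" for g h
    using that assms by (auto simp: sunflower_edge_def)
  ultimately show "e = f"
    by metis
qed

lemma degree_sunflower:
  assumes "k \<ge> 2" and "v \<in> sunflower_verts k"
  shows "card {e \<in> sunflower_edges k. v \<in> e} = (if snd v = 1 then 2 else 1)"
proof -
  let ?I = "{e. e < k \<and> v \<in> sunflower_edge k e}"
  have "{e \<in> sunflower_edges k. v \<in> e} = sunflower_edge k ` ?I"
    using assms(1) by (auto simp: sunflower_edges_eq)
  then have "card {e \<in> sunflower_edges k. v \<in> e} = card ?I"
    using inj_on_sunflower_edge[of k] assms(1)
    by (simp add: card_image inj_on_subset[of _ "{..<k}"] subset_eq)
  \<comment> \<open>The centre \<open>(0, 0)\<close> fits the pattern: its first coordinate 0 is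
    also the number of the central edge.\<close>
  also have "?I = (if snd v = 1 then {0, fst v} else {fst v})"
    using assms by (auto simp: sunflower_verts_def sunflower_edge_def split: if_splits)
  also have "card \<dots> = (if snd v = 1 then 2 else 1)"
    using assms(2) by (auto simp: sunflower_verts_def)
  finally show ?thesis .
qed

text \<open>The leading \<open>t\<close> belongs to the centre \<open>(0, 0)\<close>; each petal has
  one vertex of degree 2 and \<open>k - 1\<close> of degree 1.\<close>

lemma prod_sunflower_verts:
  assumes "k \<ge> 2"
  shows "(\<Prod>v\<in>sunflower_verts k. if snd v = 1 then s else t) =
    (t :: 'a :: comm_monoid_mult) * (s * t ^ (k - 1)) ^ (k - 1)"
proof -
  have "(\<Prod>j\<in>{1..k}. if j = 1 then s else t) = s * t ^ (k - 1)"
  proof -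
    have "{1..k} = insert 1 {2..k}"
      using assms by auto
    then show ?thesis
      by simp
  qed
  moreover have "(\<Prod>v\<in>{1..k - 1} \<times> {1..k}. if snd v = 1 then s else t) =
      (\<Prod>i\<in>{1..k - 1}. \<Prod>j\<in>{1..k}. if j = 1 then s else t)"
    by (subst prod.cartesian_product) (auto intro!: prod.cong)
  ultimately show ?thesis
    by (simp add: sunflower_verts_def)
qed

text \<open>With \<open>s\<close> and \<open>t\<close> the reciprocals of degree plus
  \<open>x\<close>, these sums are the entries subtracted from the identity in the edge-indexed
  matrix.\<close>

lemma sum_sunflower_edge_inter:
  fixes s t :: "'a :: comm_semiring_1"
  assumes "k \<ge> 2" and "e < k" and "f < k"
  shows "(\<Sum>v \<in> sunflower_edge k e \<inter> sunflower_edge k f. if snd v = 1 then s else t) =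
    (if e = f then (if e = 0 then t + of_nat (k - 1) * s else s + of_nat (k - 1) * t)
     else if e = 0 \<or> f = 0 then s else 0)"
proof -
  let ?w = "\<lambda>v :: nat \<times> nat. if snd v = 1 then s else t"
  have centre: "sum ?w (sunflower_edge k 0) = t + of_nat (k - 1) * s"
  proof -
    have "sum ?w ({1..k - 1} \<times> {1}) = (\<Sum>v\<in>{1..k - 1} \<times> {1::nat}. s)"
      by (intro sum.cong) auto
    then show ?thesis
      by (simp add: sunflower_edge_def card_cartesian_product)
  qed
  have petal: "sum ?w (sunflower_edge k e) = s + of_nat (k - 1) * t" if "e \<noteq> 0" for e
  proof -
    have "sunflower_edge k e = insert (e, 1) ({e} \<times> {2..k})"
      using that assms(1) by (auto simp: sunflower_edge_def)
    moreover have "sum ?w ({e} \<times> {2..k}) = (\<Sum>v\<in>{e} \<times> {2..k}. t)"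
      by (intro sum.cong) auto
    ultimately show ?thesis
      by (simp add: card_cartesian_product)
  qed
  \<comment> \<open>When one index is 0, \<open>max e f\<close> is the number of the petal.\<close>
  have inter: "sunflower_edge k e \<inter> sunflower_edge k f =
      (if e = 0 \<or> f = 0 then {(max e f, 1)} else {})" if "e \<noteq> f"
    using that assms by (auto simp: sunflower_edge_def max_def)
  show ?thesis
    using centre petal inter by auto
qed

section \<open>The characteristic polynomial of the sunflower\<close>

text \<open>The sign reconciles leading coefficients: the order \<open>k * (k - 1) + 1\<close> is
  odd, so the determinant has leading coefficient -1, while the product of the three factors has
  \<open>(- 1) ^ (k - 2)\<close>.\<close>

theorem theorem6p1:
  fixes k :: nat and vs :: "(nat \<times> nat) list"
  assumes "k \<ge> 2"
    and "distinct vs" and "set vs = sunflower_verts k"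
  shows "char_polynomial (adjacency_matrix (sunflower_edges k) vs) =
    (- 1) ^ (k - 1) *
    ([:1, 1:] ^ ((k - 1) * (k - 2)) *
     [:2 - 3 * real k + real k ^ 2, 6 - 6 * real k + real k ^ 2, 4 - 2 * real k, 1:] *
     [:- 3 + 2 * real k, real k - 3, - 1:] ^ (k - 2))"
proof (rule poly_eqI_nonroot)
  \<comment> \<open>The first two factors are the values of degree plus \<open>x\<close>; the
    quadratic is, up to sign, the numerator of the pivot \<open>a\<close> below.\<close>
  let ?r = "[:1, 1:] * [:2, 1:] * [:- 3 + 2 * real k, real k - 3, - 1:]"
  show "?r \<noteq> 0"
    by (simp only: mult_eq_0_iff) simp
  fix x assume "poly ?r x \<noteq> 0"
  define u w q where "u = 1 + x" and "w = 2 + x" and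
    "q = x\<^sup>2 + (3 - real k) * x + (3 - 2 * real k)"
  define P where "P = 2 - 3 * real k + real k ^ 2 + (6 - 6 * real k + real k ^ 2) * x +
    (4 - 2 * real k) * x\<^sup>2 + x ^ 3"
  have Q: "poly [:- 3 + 2 * real k, real k - 3, - 1:] x = - q"
    by (simp add: q_def algebra_simps power2_eq_square)
  have "poly ?r x = u * w * - q"
    unfolding poly_mult Q by (simp add: u_def w_def)
  with \<open>poly ?r x \<noteq> 0\<close> have nz: "u \<noteq> 0" "w \<noteq> 0" "q \<noteq> 0"
    by simp_all
  obtain n where k: "k = n + 2"
    using \<open>k \<ge> 2\<close> by (metis add.commute le_Suc_ex)
  \<comment> \<open>Entries of the arrow matrix: \<open>a\<close> on the diagonal for petals,
    \<open>b\<close> at the corner for the central edge, \<open>c\<close> where the central edge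
    meets a petal.\<close>
  define a b c where "a = 1 - (1 / w + real (n + 1) * (1 / u))"
    and "b = 1 - (1 / u + real (n + 1) * (1 / w))" and "c = - 1 / w"
  have a: "a = q / (u * w)"
    using nz(1,2) unfolding a_def q_def k
    by (simp add: field_simps) (simp add: u_def w_def algebra_simps power2_eq_square)
  have weight: "real (card {e \<in> sunflower_edges k. v \<in> e}) + x = (if snd v = 1 then w else u)"
    if "v \<in> sunflower_verts k" for v
    using degree_sunflower[OF \<open>k \<ge> 2\<close> that] by (simp add: u_def w_def)
  have edge_subset: "sunflower_edge k e \<subseteq> sunflower_verts k" if "e < k" for e
    using that by (auto simp: sunflower_edge_def sunflower_verts_def)
  have sum: "(\<Sum>v \<in> set vs \<inter> (sunflower_edge k e \<inter> sunflower_edge k f).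
        1 / (real (card {e \<in> sunflower_edges k. v \<in> e}) + x)) =
      (if e = f then (if e = 0 then 1 / u + real (k - 1) * (1 / w) else 1 / w + real (k - 1) * (1 / u))
       else if e = 0 \<or> f = 0 then 1 / w else 0)" (is "?S = _") if "e < k" "f < k" for e f
  proof -
    have "?S = (\<Sum>v \<in> sunflower_edge k e \<inter> sunflower_edge k f. if snd v = 1 then 1 / w else 1 / u)"
      using edge_subset[OF that(1)] assms(3) weight by (intro sum.cong) auto
    then show ?thesis
      by (simp only: sum_sunflower_edge_inter[OF \<open>k \<ge> 2\<close> that])
  qed
  have len: "length vs = k * (k - 1) + 1"
    using distinct_card[OF assms(2)] assms(3) card_sunflower_verts[of k] by simp
  have "poly (char_polynomial (adjacency_matrix (sunflower_edges k) vs)) x =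
      (- 1) ^ length vs * (\<Prod>v\<in>sunflower_verts k. if snd v = 1 then w else u) *
      det (mat k k (\<lambda>(e, f). of_bool (e = f) -
        (\<Sum>v \<in> set vs \<inter> (sunflower_edge k e \<inter> sunflower_edge k f).
          1 / (real (card {e \<in> sunflower_edges k. v \<in> e}) + x))))"
    using poly_char_polynomial_adjacency[OF assms(2) inj_on_sunflower_edge sunflower_edges_eq, of k x]
      assms(1,3) weight nz by simp
  also have "mat k k (\<lambda>(e, f). of_bool (e = f) -
        (\<Sum>v \<in> set vs \<inter> (sunflower_edge k e \<inter> sunflower_edge k f).
          1 / (real (card {e \<in> sunflower_edges k. v \<in> e}) + x))) =
      mat k k (\<lambda>(e, f).
        if e = f then (if e = 0 then b else a) else if e = 0 \<or> f = 0 then c else 0)"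
    by (rule eq_matI; simp only: dim_row_mat dim_col_mat index_mat case_prod_conv sum)
      (simp_all add: k a_def b_def c_def)
  also have "det \<dots> = a ^ (n + 1) * (b - real (n + 1) * c\<^sup>2 / a)"
    using det_arrow_mat[of a "n + 1" b c] nz by (simp add: a k)
  also have "(\<Prod>v\<in>sunflower_verts k. if snd v = 1 then w else u) = u * (w * u ^ (n + 1)) ^ (n + 1)"
    using prod_sunflower_verts[OF \<open>k \<ge> 2\<close>, of w u] by (simp add: k)
  \<comment> \<open>\<open>k * (k - 1)\<close> is even, so the number of vertices is odd.\<close>
  also have "(- 1) ^ length vs = (- 1 :: real)"
    unfolding len k by simp
  also have "- 1 * (u * (w * u ^ (n + 1)) ^ (n + 1)) * (a ^ (n + 1) * (b - real (n + 1) * c\<^sup>2 / a)) =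
      - (u ^ ((n + 1) * n) * q ^ n) * (u * q * (b - real (n + 1) * c\<^sup>2 / a))"
  proof -
    \<comment> \<open>By the value of \<open>a\<close>, each base \<open>w * u ^ (n + 1) * a\<close>
      equals \<open>u ^ n * q\<close>. One factor \<open>q\<close> is then split off to cancel the
      denominator coming from \<open>c\<^sup>2 / a\<close>.\<close>
    have "(w * u ^ (n + 1)) ^ (n + 1) * a ^ (n + 1) = (u ^ n * q) ^ (n + 1)"
      unfolding a power_mult_distrib[symmetric] using nz by (simp add: field_simps)
    also have "\<dots> = u ^ ((n + 1) * n) * q ^ n * q"
      by (simp add: power_mult_distrib power_add algebra_simps flip: power_mult)
    finally have powers: "(w * u ^ (n + 1)) ^ (n + 1) * a ^ (n + 1) =
      u ^ ((n + 1) * n) * q ^ n * q" .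
    have "- 1 * (u * y) * (z * t) = - p * (u * q * t)" if "y * z = p * q" for y z p t :: real
    proof -
      have "- 1 * (u * y) * (z * t) = - (y * z) * (u * t)"
        by (simp add: mult_ac)
      then show ?thesis
        unfolding that by (simp add: mult_ac)
    qed
    from this[OF powers] show ?thesis .
  qed
  also have "u * q * (b - real (n + 1) * c\<^sup>2 / a) = P"
  proof -
    have "u * q * (b - real (n + 1) * c\<^sup>2 / a) = u * q * b - real (n + 1) * u\<^sup>2 / w"
      using nz unfolding a c_def by (simp add: field_simps power2_eq_square)
    also have "\<dots> = (q * (u * w - w - real (n + 1) * u) - real (n + 1) * u\<^sup>2) / w"
      using nz unfolding b_def by (simp add: field_simps)
    \<comment> \<open>The quartic numerator is divisible by \<open>w\<close>, so the last
      denominator disappears and the cubic \<open>P\<close> remains.\<close>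
    also have "q * (u * w - w - real (n + 1) * u) - real (n + 1) * u\<^sup>2 = P * w"
      unfolding q_def u_def w_def P_def k
      by (simp add: algebra_simps power2_eq_square power3_eq_cube)
    finally show ?thesis
      using nz by simp
  qed
  \<comment> \<open>The sign arises from \<open>- (q ^ n) = (- 1) ^ (n + 1) * (- q) ^ n\<close>,
    where \<open>n + 1 = k - 1\<close>.\<close>
  also have "- (u ^ ((n + 1) * n) * q ^ n) * P =
      (- 1) ^ (k - 1) * (u ^ ((k - 1) * (k - 2)) * P * (- q) ^ (k - 2))"
    unfolding power_minus[of q] k by (simp add: algebra_simps flip: power_add)
  also have "\<dots> = poly ((- 1) ^ (k - 1) *
    ([:1, 1:] ^ ((k - 1) * (k - 2)) *
     [:2 - 3 * real k + real k ^ 2, 6 - 6 * real k + real k ^ 2, 4 - 2 * real k, 1:] *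
     [:- 3 + 2 * real k, real k - 3, - 1:] ^ (k - 2))) x"
    unfolding poly_mult poly_power Q
    by (simp add: u_def P_def algebra_simps power2_eq_square power3_eq_cube)
  finally show "poly (char_polynomial (adjacency_matrix (sunflower_edges k) vs)) x =
    poly ((- 1) ^ (k - 1) *
    ([:1, 1:] ^ ((k - 1) * (k - 2)) *
     [:2 - 3 * real k + real k ^ 2, 6 - 6 * real k + real k ^ 2, 4 - 2 * real k, 1:] *
     [:- 3 + 2 * real k, real k - 3, - 1:] ^ (k - 2))) x" .
qed

end
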